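(* Let $R$ be a multiplicatively cancellative perfect semi-ring of characteristic one, and let $G=R^\times$ be its group of invertible elements with the partial order induced from $R$. Assume that $G$ is a partially ordered vector space over $\mathbb{R}$ (with scalar action, written multiplicatively, $\theta_\lambda(x)=x^\lambda$, extending the rational powers), and that the order is closed in the following sense: if $\lambda_n\to\lambda$ in $\mathbb{R}$ and $x,y\in G$ satisfy $\theta_{\lambda_n}(x)\ge y$ for all $n$, then $\theta_\lambda(x)\ge y$. Let $I=\mathbb{Q}\cap(0,1)$ and let $w:I\to G$ satisfy $$w(1-\alpha)=w(\alpha)\quad\text{for all }\alpha\in I,$$ $$w(\alpha)\,w(\beta)^{\alpha}=w(\alpha\beta)\,w\!\left(\frac{\alpha(1-\beta)}{1-\alpha\beta}\right)^{1-\alpha\beta}\quad\text{for all }\alpha,\beta\in I,$$ and $$w(\alpha)\ge 1\quad\text{for all }\alpha\in I.$$ Then there exists $\rho\in G$ with $\rho\ge1$ such that $$w(\alpha)=\rho^{S(\alpha)},\qquad S(\alpha)=-\alpha\log(\alpha)-(1-\alpha)\log(1-\alpha),\qquad\text{for all }\alpha\in I.$$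
   Context: Semi-rings are commutative, with $0$ and $1\ne0$. A semi-ring $R$ has characteristic one if $1+1=1$ (hence $a+a=a$ for all $a\in R$); it then carries the canonical partial order $x\le y\iff x+y=y$. $R$ is multiplicatively cancellative if $x\ne0$ and $xy=xz$ imply $y=z$. For such $R$ of characteristic one the maps $x\mapsto x^n$ ($n\ge1$) are injective endomorphisms; $R$ is called perfect if they are all surjective. Then for $\alpha=a/b\in\mathbb{Q}_+^*$, $x^\alpha=\theta_\alpha(x)$ denotes the unique $z\in R$ with $z^b=x^a$. That $G$ is a partially ordered real vector space means: there are group endomorphisms $\theta_\lambda$ of $G$ for $\lambda\in\mathbb{R}$ (automorphisms for $\lambda\neq0$), with $\theta_0(x)=1$, $\theta_1=\mathrm{id}$, $\theta_{\lambda\lambda'}=\theta_\lambda\circ\theta_{\lambda'}$, $\theta_\lambda(x)\theta_{\lambda'}(x)=\theta_{\lambda+\lambda'}(x)$, agreeing with rational powers for $\lambda\in\mathbb{Q}$, and the order on $G$ is compatible with multiplication and with $\theta_\lambda$ for $\lambda\geq 0$ ($x\le y$ implies $xz\le yz$ and $x^\lambda\le y^\lambda$). *)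

theory Defs
  imports Complex_Main
begin

class char_one_semiring = comm_semiring_1 +
  assumes char_one: "1 + 1 = 1"

class cancel_perfect_char_one_semiring = char_one_semiring +
  assumes mult_cancel: "x \<noteq> 0 \<Longrightarrow> x * y = x * z \<Longrightarrow> y = z"
    and perfect: "n \<ge> 1 \<Longrightarrow> surj (\<lambda>x. x ^ n)"

definition char_one_le :: "'a::char_one_semiring \<Rightarrow> 'a \<Rightarrow> bool"  (infix "\<preceq>" 50)
  where "x \<preceq> y \<longleftrightarrow> x + y = y"

definition unit_group :: "'a::comm_semiring_1 set"
  where "unit_group = {x. x dvd 1}"

text \<open>The power \<open>x\<close> to the exponent \<open>a / b\<close>, for \<open>a, b \<ge> 1\<close>. The description is
  well defined by \<open>ex1_frac_power\<close> below.\<close>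

definition frac_power :: "nat \<Rightarrow> nat \<Rightarrow> 'a::cancel_perfect_char_one_semiring \<Rightarrow> 'a"
  where "frac_power a b x = (THE z. z ^ b = x ^ a)"

text \<open>The group of units is written multiplicatively, so \<open>\<theta> r x\<close> is the scalar multiple
  \<open>x\<^sup>r\<close>; the values of \<open>\<theta> r\<close> outside the group are irrelevant.\<close>

locale ordered_real_unit_group =
  fixes \<theta> :: "real \<Rightarrow> 'a::cancel_perfect_char_one_semiring \<Rightarrow> 'a"
  assumes closed: "x \<in> unit_group \<Longrightarrow> \<theta> r x \<in> unit_group"
    and mult: "x \<in> unit_group \<Longrightarrow> y \<in> unit_group \<Longrightarrow> \<theta> r (x * y) = \<theta> r x * \<theta> r y"
    and automorphism: "r \<noteq> 0 \<Longrightarrow> bij_betw (\<theta> r) unit_group unit_group"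
    and zero: "x \<in> unit_group \<Longrightarrow> \<theta> 0 x = 1"
    and one: "x \<in> unit_group \<Longrightarrow> \<theta> 1 x = x"
    and comp: "x \<in> unit_group \<Longrightarrow> \<theta> (r * s) x = \<theta> r (\<theta> s x)"
    and add: "x \<in> unit_group \<Longrightarrow> \<theta> r x * \<theta> s x = \<theta> (r + s) x"
    and rational: "x \<in> unit_group \<Longrightarrow> a \<ge> 1 \<Longrightarrow> b \<ge> 1 \<Longrightarrow>
      \<theta> (real a / real b) x = frac_power a b x"
    and le_mult: "x \<in> unit_group \<Longrightarrow> y \<in> unit_group \<Longrightarrow> z \<in> unit_group \<Longrightarrow>
      x \<preceq> y \<Longrightarrow> x * z \<preceq> y * z"
    and le_scale: "x \<in> unit_group \<Longrightarrow> y \<in> unit_group \<Longrightarrow> r \<ge> 0 \<Longrightarrow>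
      x \<preceq> y \<Longrightarrow> \<theta> r x \<preceq> \<theta> r y"

definition entropy :: "real \<Rightarrow> real"
  where "entropy \<alpha> = - \<alpha> * ln \<alpha> - (1 - \<alpha>) * ln (1 - \<alpha>)"

lemma add_idem: "(a::'a::char_one_semiring) + a = a"
  by (metis char_one distrib_left mult.right_neutral)

lemma char_one_le_refl: "x \<preceq> x"
  by (simp add: char_one_le_def add_idem)

lemma char_one_le_antisym: "x \<preceq> y \<Longrightarrow> y \<preceq> x \<Longrightarrow> x = y"
  by (simp add: char_one_le_def add.commute)

lemma char_one_le_trans: "x \<preceq> y \<Longrightarrow> y \<preceq> z \<Longrightarrow> x \<preceq> z"
  unfolding char_one_le_def by (metis add.assoc)

lemma char_one_le_mult_left: "x \<preceq> y \<Longrightarrow> z * x \<preceq> z * y"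
  unfolding char_one_le_def by (metis distrib_left)

lemma char_one_le_mult: "x \<preceq> y \<Longrightarrow> z \<preceq> u \<Longrightarrow> x * z \<preceq> y * u"
  by (metis char_one_le_mult_left char_one_le_trans mult.commute)

lemma char_one_le_power: "x \<preceq> y \<Longrightarrow> x ^ n \<preceq> y ^ n"
  by (induction n) (auto intro: char_one_le_refl char_one_le_mult)

lemma char_one_le_add: "x \<preceq> x + y"
  unfolding char_one_le_def by (metis add.assoc add_idem)

lemma char_one_sum_le: "(\<And>i. i \<in> A \<Longrightarrow> f i \<preceq> b) \<Longrightarrow> sum f A \<preceq> b"
  by (induction A rule: infinite_finite_induct) (auto simp: char_one_le_def add.assoc)

lemma power_add_monomials:
  fixes x y :: "'a::char_one_semiring"
  shows "(x + y) ^ n = (\<Sum>i\<le>n. x ^ i * y ^ (n - i))"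
proof -
  have 1: "(of_nat (Suc k) :: 'a) = 1" for k
    by (induction k) (simp_all add: char_one add_idem)
  have "of_nat (n choose i) = (1::'a)" if "i \<le> n" for i
    using 1[of "(n choose i) - 1"] that by simp
  then show ?thesis
    unfolding binomial_ring by (intro sum.cong) auto
qed

lemma power_add_le:
  fixes x y :: "'a::char_one_semiring"
  shows "(x + y) ^ (n + n) \<preceq> (x ^ n + y ^ n) * (x + y) ^ n"
  unfolding power_add_monomials[of x y "n + n"]
proof (rule char_one_sum_le)
  have *: "u ^ i * v ^ (n + n - i) \<preceq> (u ^ n + v ^ n) * (u + v) ^ n"
    if "n \<le> i" "i \<le> n + n" for i and u v :: 'a
  proof -
    have "u ^ i * v ^ (n + n - i) = u ^ n * (u ^ (i - n) * v ^ (n + n - i))"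
      using that by (simp add: mult.assoc[symmetric] power_add[symmetric])
    moreover have "u ^ (i - n) * v ^ (n + n - i) \<preceq> (u + v) ^ (i - n) * (u + v) ^ (n + n - i)"
      by (intro char_one_le_mult char_one_le_power) (metis char_one_le_add add.commute)+
    moreover have "(u + v) ^ (i - n) * (u + v) ^ (n + n - i) = (u + v) ^ n"
      using that by (simp add: power_add[symmetric])
    ultimately show ?thesis
      by (metis char_one_le_mult char_one_le_add)
  qed
  fix i assume i: "i \<in> {..n + n}"
  show "x ^ i * y ^ (n + n - i) \<preceq> (x ^ n + y ^ n) * (x + y) ^ n"
  proof (cases "n \<le> i")
    case True
    with i show ?thesis by (intro *) auto
  next
    case False
    with i show ?thesis
      using *[of "n + n - i" y x] by (simp add: add.commute mult.commute)
  qed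
qed

lemma char_one_power_inject:
  fixes x y :: "'a::cancel_perfect_char_one_semiring"
  assumes "n \<ge> 1" and eq: "x ^ n = y ^ n"
  shows "x = y"
proof -
  have nz: "u ^ k \<noteq> 0" if "u \<noteq> 0" for u :: 'a and k
  proof (induction k)
    case (Suc k)
    with that show ?case by (metis mult_cancel mult_zero_right power_Suc)
  qed simp
  have *: "u = u + v" if e: "u ^ n = v ^ n" for u v :: 'a
  proof (cases "u + v = 0")
    case True
    then show ?thesis by (metis char_one_le_add char_one_le_def add_0_right)
  next
    case False
    define s where "s = u + v"
    have le: "u \<preceq> s" unfolding s_def by (rule char_one_le_add)
    have "s ^ n * s ^ n \<preceq> s ^ n * u ^ n"
      using power_add_le[of u v n] by (simp add: s_def e add_idem power_add mult.commute)
    moreover have "s ^ n * u ^ n \<preceq> s ^ n * s ^ n"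
      by (intro char_one_le_mult_left char_one_le_power le)
    ultimately have "s ^ n * s ^ n = s ^ n * u ^ n"
      by (rule char_one_le_antisym)
    then have sn: "s ^ n = u ^ n"
      using mult_cancel nz False by (metis s_def)
    obtain m where m: "n = Suc m" using \<open>n \<ge> 1\<close> by (cases n) auto
    have "s ^ m * s \<preceq> s ^ m * u"
      using sn char_one_le_mult[OF char_one_le_power[OF le, of m] char_one_le_refl[of u]]
      by (simp add: m mult.commute)
    moreover have "s ^ m * u \<preceq> s ^ m * s"
      by (intro char_one_le_mult_left le)
    ultimately have "s ^ m * s = s ^ m * u"
      by (rule char_one_le_antisym)
    then show ?thesis
      using mult_cancel nz False by (metis s_def)
  qed
  show ?thesis
    using *[OF eq] *[OF eq[symmetric]] by (simp add: add.commute)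
qed

lemma ex1_frac_power:
  fixes x :: "'a::cancel_perfect_char_one_semiring"
  assumes "b \<ge> 1"
  shows "\<exists>!z. z ^ b = x ^ a"
proof -
  obtain z where "z ^ b = x ^ a"
    using perfect[OF assms, THEN surjD, of "x ^ a"] by metis
  then show ?thesis
    using char_one_power_inject[OF assms] by metis
qed

end

theory Submission
  imports Defs
begin

text \<open>
  Write \<open>G\<close> additively. The functional equation is the fundamental equation of information
  theory with values in an ordered vector space: clearing denominators, the function
  \<open>H m n = (m + n) w (m / (m + n))\<close> of two positive integers is a symmetric 2-cocycle,
  homogeneous of degree one (\<open>H_cocycle\<close>, \<open>H_homogeneous\<close>). As positive integers are sums
  of ones, the cocycle is the coboundary of \<open>h n = H 1 1 + \<dots> + H 1 (n - 1)\<close>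
  (\<open>h_add\<close>), and homogeneity turns into the Leibniz rule \<open>h (k m) = k h m + m h k\<close>
  (\<open>h_mult\<close>). So \<open>L n = h n / n\<close> satisfies \<open>L (m n) = L m + L n\<close>: it is the entropy of
  the uniform distribution on \<open>n\<close> points.

  It remains to see that \<open>L\<close> is a multiple of the logarithm, and here positivity of \<open>w\<close>
  enters. It says at once that \<open>h\<close> is increasing, which for \<open>L\<close> itself gives only
  \<open>(m / n) L m \<le> L n\<close> when \<open>m \<le> n\<close>. For \<open>m < n\<close> this is applied to
  \<open>n ^ k\<close> and the largest multiple of \<open>m ^ k\<close> below it; the loss disappears as \<open>k\<close> grows,
  and \<open>L\<close> is increasing (\<open>L_mono\<close>). Then \<open>m ^ p \<le> n ^ q\<close> implies
  \<open>p L m \<le> q L n\<close>, and letting \<open>p / q\<close> increase to \<open>ln n / ln m\<close> gives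
  \<open>(ln n / ln m) L m \<le> L n\<close> (\<open>L_ln_le\<close>). Exchanging \<open>m\<close> and \<open>n\<close> gives equality, so
  \<open>L n = (ln n) \<rho>\<close> with \<open>\<rho> = L 2 / ln 2\<close>, and the coboundary formula for \<open>H\<close> becomes
  the entropy formula for \<open>w\<close>. Both limits are taken along the multiples of one vector, which
  is exactly what closedness of the order permits.
\<close>

section \<open>Ordered real vector spaces with closed order\<close>

locale closed_ordered_vector_space = vector_space scale
  for scale :: "real \<Rightarrow> 'v::ab_group_add \<Rightarrow> 'v"  (infixr "*s" 75) +
  fixes le :: "'v \<Rightarrow> 'v \<Rightarrow> bool"  (infix "\<sqsubseteq>" 50)
  assumes refl: "x \<sqsubseteq> x"
    and antisym: "x \<sqsubseteq> y \<Longrightarrow> y \<sqsubseteq> x \<Longrightarrow> x = y"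
    and trans [trans]: "x \<sqsubseteq> y \<Longrightarrow> y \<sqsubseteq> z \<Longrightarrow> x \<sqsubseteq> z"
    and add_right_mono: "x \<sqsubseteq> y \<Longrightarrow> x + z \<sqsubseteq> y + z"
    and scale_mono: "r \<ge> 0 \<Longrightarrow> x \<sqsubseteq> y \<Longrightarrow> r *s x \<sqsubseteq> r *s y"
    and closed_below: "s \<longlonglongrightarrow> r \<Longrightarrow> (\<And>n::nat. y \<sqsubseteq> s n *s x) \<Longrightarrow> y \<sqsubseteq> r *s x"
begin

lemma minus_mono: "x \<sqsubseteq> y \<Longrightarrow> - y \<sqsubseteq> - x"
  using add_right_mono[of x y "- x - y"] by simp

lemma le_iff_diff_nonneg: "x \<sqsubseteq> y \<longleftrightarrow> 0 \<sqsubseteq> y - x"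
  using add_right_mono[of x y "- x"] add_right_mono[of 0 "y - x" x] by auto

lemma scale_nonneg: "r \<ge> 0 \<Longrightarrow> 0 \<sqsubseteq> x \<Longrightarrow> 0 \<sqsubseteq> r *s x"
  using scale_mono[of r 0 x] by simp

lemma scale_left_mono: "r \<le> s \<Longrightarrow> 0 \<sqsubseteq> x \<Longrightarrow> r *s x \<sqsubseteq> s *s x"
  using scale_nonneg[of "s - r" x] by (simp add: le_iff_diff_nonneg[of "r *s x"] scale_left_diff_distrib)

lemma scale_le_cancel:
  assumes "r > 0" "r *s x \<sqsubseteq> r *s y"
  shows "x \<sqsubseteq> y"
  using scale_mono[of "1 / r" "r *s x" "r *s y"] assms by simp

text \<open>Negation turns lower bounds for the multiples of \<open>- x\<close> into upper bounds for those of
  \<open>x\<close>, so the one-sided closedness axiom gives the other side as well.\<close>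

lemma closed_above:
  assumes "s \<longlonglongrightarrow> r" "\<And>n::nat. s n *s x \<sqsubseteq> y"
  shows "r *s x \<sqsubseteq> y"
proof -
  have "- y \<sqsubseteq> s n *s (- x)" for n
    using minus_mono[OF assms(2)] by simp
  then have "- y \<sqsubseteq> r *s (- x)"
    by (rule closed_below[OF assms(1)])
  then show ?thesis
    using minus_mono by fastforce
qed

end

section \<open>Nonnegative information functions\<close>

locale nonneg_information_function = closed_ordered_vector_space scale le
  for scale :: "real \<Rightarrow> 'v::ab_group_add \<Rightarrow> 'v"  (infixr "*s" 75)
    and le :: "'v \<Rightarrow> 'v \<Rightarrow> bool"  (infix "\<sqsubseteq>" 50) +
  fixes w :: "real \<Rightarrow> 'v"
  assumes symmetric: "\<alpha> \<in> \<rat> \<inter> {0<..<1} \<Longrightarrow> w (1 - \<alpha>) = w \<alpha>"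
    and fundamental: "\<alpha> \<in> \<rat> \<inter> {0<..<1} \<Longrightarrow> \<beta> \<in> \<rat> \<inter> {0<..<1} \<Longrightarrow>
      w \<alpha> + \<alpha> *s w \<beta> = w (\<alpha> * \<beta>) + (1 - \<alpha> * \<beta>) *s w (\<alpha> * (1 - \<beta>) / (1 - \<alpha> * \<beta>))"
    and nonneg: "\<alpha> \<in> \<rat> \<inter> {0<..<1} \<Longrightarrow> 0 \<sqsubseteq> w \<alpha>"
begin

text \<open>The homogeneous form of \<open>w\<close>: for masses \<open>m\<close> and \<open>n\<close> it is the information gained by
  telling the two parts apart, weighted by the total mass.\<close>

definition H :: "nat \<Rightarrow> nat \<Rightarrow> 'v"
  where "H m n = real (m + n) *s w (real m / real (m + n))"

lemma ratio_in_unit_interval: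
  "m \<ge> 1 \<Longrightarrow> n \<ge> 1 \<Longrightarrow> real m / real (m + n) \<in> \<rat> \<inter> {0<..<1}"
  by (auto simp: field_simps)

lemma H_commute: "m \<ge> 1 \<Longrightarrow> n \<ge> 1 \<Longrightarrow> H m n = H n m"
  using symmetric[OF ratio_in_unit_interval[of m n]]
  by (simp add: H_def field_simps add.commute)

lemma H_nonneg: "m \<ge> 1 \<Longrightarrow> n \<ge> 1 \<Longrightarrow> 0 \<sqsubseteq> H m n"
  unfolding H_def by (intro scale_nonneg nonneg ratio_in_unit_interval) auto

lemma H_homogeneous: "k \<ge> 1 \<Longrightarrow> H (k * m) (k * n) = real k *s H m n"
  by (simp add: H_def distrib_left[symmetric] del: distrib_left_numeral)

text \<open>Both sides are the information of a partition into masses \<open>x\<close>, \<open>y\<close>, \<open>z\<close>, found by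
  splitting first into \<open>x + y\<close> and \<open>z\<close>, or first into \<open>x\<close> and \<open>y + z\<close>. The fundamental
  equation at \<open>\<alpha> = (x + y) / (x + y + z)\<close> and \<open>\<beta> = x / (x + y)\<close> is this identity divided
  by the total mass.\<close>

lemma H_cocycle:
  assumes "x \<ge> 1" "y \<ge> 1" "z \<ge> 1"
  shows "H x y + H (x + y) z = H x (y + z) + H y z"
proof -
  define N where "N = real (x + y + z)"
  define \<alpha> where "\<alpha> = real (x + y) / real (x + y + z)"
  define \<beta> where "\<beta> = real x / real (x + y)"
  have N: "N > 0" using assms by (simp add: N_def)
  have ab: "\<alpha> * \<beta> = real x / N"
    using assms by (simp add: \<alpha>_def \<beta>_def N_def del: of_nat_add)
  have ab': "1 - \<alpha> * \<beta> = real (y + z) / N"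
    using N unfolding ab by (simp add: N_def diff_divide_eq_iff field_simps)
  have "\<alpha> * (1 - \<beta>) = real y / N"
    using assms ab N by (simp add: right_diff_distrib) (simp add: \<alpha>_def N_def diff_divide_distrib[symmetric])
  then have quotient: "\<alpha> * (1 - \<beta>) / (1 - \<alpha> * \<beta>) = real y / real (y + z)"
    using N unfolding ab' by simp
  have "\<alpha> \<in> \<rat> \<inter> {0<..<1}" "\<beta> \<in> \<rat> \<inter> {0<..<1}"
    unfolding \<alpha>_def \<beta>_def using assms by (intro ratio_in_unit_interval; simp)+
  from fundamental[OF this, unfolded quotient, unfolded ab', unfolded ab]
  have "N *s (w \<alpha> + \<alpha> *s w \<beta>) =
      N *s (w (real x / N) + (real (y + z) / N) *s w (real y / real (y + z)))"
    by simp
  moreover have "N * \<alpha> = real (x + y)"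
    using assms by (simp add: N_def \<alpha>_def)
  ultimately show ?thesis
    using N by (simp add: scale_right_distrib H_def N_def[symmetric] \<alpha>_def \<beta>_def add.assoc)
      (simp add: N_def add_ac)
qed

definition h :: "nat \<Rightarrow> 'v"
  where "h n = (\<Sum>k = 1..<n. H 1 k)"

lemma h_1: "h 1 = 0"
  by (simp add: h_def)

lemma h_Suc: "n \<ge> 1 \<Longrightarrow> h (Suc n) = h n + H 1 n"
  by (simp add: h_def)

text \<open>The cocycle identity with middle argument 1 moves a unit from \<open>n\<close> to \<open>m\<close>; this is the
  induction step that integrates \<open>H\<close>.\<close>

lemma h_add:
  assumes "m \<ge> 1" "n \<ge> 1"
  shows "h (m + n) = h m + h n + H m n"
  using assms
proof (induction m arbitrary: n rule: nat_induct_at_least)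
  case base
  then show ?case by (simp add: h_Suc h_def)
next
  case (Suc m)
  have "h (Suc m + n) = h m + h (Suc n) + H m (Suc n)"
    using Suc.IH[of "Suc n"] by simp
  also have "\<dots> = h m + h n + (H m (1 + n) + H 1 n)"
    using Suc.prems by (simp add: h_Suc)
  also have "\<dots> = h m + h n + (H m 1 + H (m + 1) n)"
    using Suc by (subst H_cocycle[symmetric]) auto
  also have "\<dots> = h (Suc m) + h n + H (Suc m) n"
    using Suc by (simp add: h_Suc H_commute)
  finally show ?case .
qed

text \<open>By homogeneity of \<open>H\<close>, the map \<open>m \<mapsto> h (k m) - k h m\<close> is additive, hence
  determined by its value \<open>h k\<close> at 1.\<close>

lemma h_mult:
  assumes "k \<ge> 1" "m \<ge> 1"
  shows "h (k * m) = real k *s h m + real m *s h k"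
  using assms(2)
proof (induction m rule: nat_induct_at_least)
  case base
  then show ?case using h_1 by simp
next
  case (Suc m)
  have "h (k * Suc m) = h (k * m) + h k + H (k * m) (k * 1)"
    using h_add[of "k * m" k] Suc assms(1) by (simp add: add.commute)
  also have "H (k * m) (k * 1) = real k *s H m 1"
    using assms(1) by (rule H_homogeneous)
  also have "\<dots> = real k *s H 1 m"
    using Suc by (simp add: H_commute)
  finally show ?case
    using Suc by (simp add: h_Suc scale_right_distrib scale_left_distrib)
qed

lemma h_mono:
  assumes "1 \<le> m" "m \<le> n"
  shows "h m \<sqsubseteq> h n"
  using assms(2)
proof (induction n rule: dec_induct)
  case base
  show ?case by (rule refl)
next
  case (step n)
  have "h n \<sqsubseteq> h (Suc n)"
    using step assms(1) by (simp add: h_Suc le_iff_diff_nonneg[of "h n"] H_nonneg)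
  with step show ?case using trans by blast
qed

definition L :: "nat \<Rightarrow> 'v"
  where "L n = (1 / real n) *s h n"

lemma h_eq: "n \<ge> 1 \<Longrightarrow> h n = real n *s L n"
  by (simp add: L_def)

lemma L_1: "L 1 = 0"
  by (simp add: L_def h_def)

lemma L_nonneg: "n \<ge> 1 \<Longrightarrow> 0 \<sqsubseteq> L n"
  unfolding L_def using h_mono[of 1 n] h_1 by (intro scale_nonneg) auto

lemma L_mult:
  assumes "m \<ge> 1" "n \<ge> 1"
  shows "L (m * n) = L m + L n"
  using assms by (simp add: L_def h_mult scale_right_distrib add.commute)

lemma L_power: "n \<ge> 1 \<Longrightarrow> L (n ^ k) = real k *s L n"
  using L_1 by (induction k) (auto simp: L_mult scale_left_distrib)

text \<open>For \<open>m < n\<close> and any \<open>k\<close> let \<open>c\<close> be the integer quotient of \<open>n ^ k\<close> by \<open>m ^ k\<close>.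
  Monotonicity of \<open>h\<close> compares \<open>c m ^ k\<close> with \<open>n ^ k\<close>; since \<open>c m ^ k\<close> exceeds
  \<open>n ^ k - m ^ k\<close> and \<open>L c\<close> is nonnegative, the outcome is
  \<open>(1 - (m / n) ^ k) L m \<le> L n\<close>, where the factor tends to 1. Using a multiple of \<open>m ^ k\<close>
  matters: comparing \<open>h (m ^ k)\<close> with \<open>h (n ^ k)\<close> would leave the factor
  \<open>(m / n) ^ k\<close>.\<close>

lemma L_mono:
  assumes "1 \<le> m" "m \<le> n"
  shows "L m \<sqsubseteq> L n"
proof (cases "m = n")
  case True
  then show ?thesis by (simp add: refl)
next
  case False
  define x where "x = real m / real n"
  have x: "0 \<le> x" "x < 1" using assms False by (auto simp: x_def)
  have *: "(1 - x ^ Suc j) *s L m \<sqsubseteq> L n" for j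
  proof -
    define k where "k = Suc j"
    define c where "c = n ^ k div m ^ k"
    have mk: "m ^ k \<ge> 1" and nk: "n ^ k \<ge> 1" and mnk: "m ^ k \<le> n ^ k"
      using assms by (auto simp: power_mono)
    have c: "c \<ge> 1" "c * m ^ k \<le> n ^ k"
      using mk mnk by (auto simp: c_def Suc_le_eq div_greater_zero_iff)
    have "n ^ k < c * m ^ k + m ^ k"
      unfolding c_def using mk dividend_less_div_times[of "m ^ k" "n ^ k"] by linarith
    then have rc: "real n ^ k - real m ^ k \<le> real (c * m ^ k)"
      by (smt (verit) of_nat_add of_nat_less_iff of_nat_power)
    have coefficient: "(1 - x ^ k) * (real k * real n ^ k) = real k * (real n ^ k - real m ^ k)"
      using assms by (simp add: x_def power_divide left_diff_distrib right_diff_distrib)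
    have "(real n ^ k - real m ^ k) *s L (m ^ k) \<sqsubseteq> real (c * m ^ k) *s L (m ^ k)"
      using rc mk by (intro scale_left_mono L_nonneg)
    also have "\<dots> \<sqsubseteq> real (c * m ^ k) *s L (c * m ^ k)"
      using c mk by (intro scale_mono) (auto simp: L_mult le_iff_diff_nonneg[of "L (m ^ k)"] L_nonneg)
    also have "\<dots> = h (c * m ^ k)"
      using c mk by (intro h_eq[symmetric]) auto
    also have "\<dots> \<sqsubseteq> h (n ^ k)"
      using c mk by (intro h_mono) auto
    also have "\<dots> = real (n ^ k) *s L (n ^ k)"
      using nk by (rule h_eq)
    finally have "(real k * real n ^ k) *s ((1 - x ^ k) *s L m) \<sqsubseteq> (real k * real n ^ k) *s L n"
      using assms by (simp add: L_power coefficient mult.commute)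
    then show ?thesis
      unfolding k_def by (rule scale_le_cancel[rotated]) (use assms in auto)
  qed
  have "(\<lambda>j. 1 - x ^ Suc j) \<longlonglongrightarrow> 1 - 0"
    using x by (intro tendsto_diff tendsto_const LIMSEQ_Suc LIMSEQ_power_zero) auto
  then have "(1 - 0) *s L m \<sqsubseteq> L n"
    by (rule closed_above) (rule *)
  then show ?thesis by simp
qed

lemma L_ln_le:
  assumes "m \<ge> 2" "n \<ge> 2"
  shows "(ln (real n) / ln (real m)) *s L m \<sqsubseteq> L n"
proof -
  define r where "r = ln (real n) / ln (real m)"
  \<comment> \<open>The largest \<open>p\<close> with \<open>m ^ p \<le> n ^ (q + 1)\<close>.\<close>
  define p where "p q = nat \<lfloor>real (Suc q) * r\<rfloor>" for q
  have lm: "ln (real m) > 0" and ln: "ln (real n) > 0" using assms by auto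
  then have r: "r > 0" by (simp add: r_def)
  have p: "real (p q) \<le> real (Suc q) * r" "real (Suc q) * r - 1 \<le> real (p q)" for q
  proof -
    have "real (p q) = of_int \<lfloor>real (Suc q) * r\<rfloor>"
      unfolding p_def using r by (intro of_nat_nat) auto
    then show "real (p q) \<le> real (Suc q) * r" "real (Suc q) * r - 1 \<le> real (p q)"
      by linarith+
  qed
  have *: "(real (p q) / real (Suc q)) *s L m \<sqsubseteq> L n" for q
  proof -
    have "real (p q) * ln (real m) \<le> real (Suc q) * ln (real n)"
      using p(1)[of q] lm by (simp add: r_def field_simps)
    then have "ln (real (m ^ p q)) \<le> ln (real (n ^ Suc q))"
      using assms by (simp add: ln_realpow ln_mult algebra_simps)
    then have "real (m ^ p q) \<le> real (n ^ Suc q)"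
      using assms by (subst (asm) ln_le_cancel_iff) auto
    then have "m ^ p q \<le> n ^ Suc q" by (simp only: of_nat_le_iff)
    then have "L (m ^ p q) \<sqsubseteq> L (n ^ Suc q)"
      using assms by (intro L_mono) auto
    then have "real (Suc q) *s ((real (p q) / real (Suc q)) *s L m) \<sqsubseteq> real (Suc q) *s L n"
      using assms L_power[of m "p q"] L_power[of n "Suc q"] by simp
    then show ?thesis by (rule scale_le_cancel[rotated]) simp
  qed
  have "(\<lambda>q. real (p q) / real (Suc q)) \<longlonglongrightarrow> r"
  proof (rule real_tendsto_sandwich)
    show "\<forall>\<^sub>F q in sequentially. r + - inverse (real (Suc q)) \<le> real (p q) / real (Suc q)"
    proof (intro always_eventually allI)
      fix q
      have "r + - inverse (real (Suc q)) = (real (Suc q) * r - 1) / real (Suc q)"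
        by (simp add: field_simps)
      also have "\<dots> \<le> real (p q) / real (Suc q)"
        using p(2) by (intro divide_right_mono) auto
      finally show "r + - inverse (real (Suc q)) \<le> real (p q) / real (Suc q)" .
    qed
    show "\<forall>\<^sub>F q in sequentially. real (p q) / real (Suc q) \<le> r"
      using p(1) by (intro always_eventually allI) (simp add: field_simps)
    show "(\<lambda>q. r + - inverse (real (Suc q))) \<longlonglongrightarrow> r"
      by (rule LIMSEQ_inverse_real_of_nat_add_minus)
  qed simp
  then show ?thesis
    unfolding r_def[symmetric] by (rule closed_above) (rule *)
qed

definition \<rho> :: 'v
  where "\<rho> = (1 / ln 2) *s w (1 / 2)"

lemma \<rho>_nonneg: "0 \<sqsubseteq> \<rho>"
  unfolding \<rho>_def using nonneg[of "1 / 2"] by (intro scale_nonneg) auto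

lemma L_2: "L 2 = w (1 / 2)"
  using h_Suc[of 1] h_1 by (simp add: L_def H_def numeral_2_eq_2)

lemma L_eq_ln:
  assumes "n \<ge> 1"
  shows "L n = ln (real n) *s \<rho>"
proof (cases "n = 1")
  case True
  then show ?thesis using L_1 by simp
next
  case False
  then have n: "n \<ge> 2" using assms by simp
  have "(ln 2 / ln (real n)) *s L n \<sqsubseteq> L 2"
    using L_ln_le[of n 2] n by simp
  then have "(ln (real n) / ln 2) *s ((ln 2 / ln (real n)) *s L n) \<sqsubseteq> (ln (real n) / ln 2) *s L 2"
    using n by (intro scale_mono) auto
  then have "L n \<sqsubseteq> (ln (real n) / ln 2) *s L 2"
    using n by simp
  moreover have "(ln (real n) / ln 2) *s L 2 \<sqsubseteq> L n"
    using L_ln_le[of 2 n] n by simp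
  ultimately have "L n = (ln (real n) / ln 2) *s L 2"
    by (rule antisym)
  then show ?thesis by (simp add: \<rho>_def L_2)
qed

theorem eq_entropy:
  assumes "\<alpha> \<in> \<rat> \<inter> {0<..<1}"
  shows "w \<alpha> = entropy \<alpha> *s \<rho>"
proof -
  from assms obtain a c :: nat where "c \<noteq> 0" and ac: "\<bar>\<alpha>\<bar> = real a / real c"
    by (metis IntE Rats_abs_nat_div_natE)
  define b where "b = c - a"
  have \<alpha>: "\<alpha> = real a / real c" using ac assms by auto
  then have ac': "a \<ge> 1" "a < c"
    using assms \<open>c \<noteq> 0\<close> by (cases a; auto simp: field_simps)+
  then have c: "c = a + b" and ab: "a \<ge> 1" "b \<ge> 1"
    by (auto simp: b_def)
  \<comment> \<open>The coboundary formula for \<open>H\<close> at \<open>(a, b)\<close> is the entropy of \<open>(a / c, b / c)\<close>.\<close>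
  have "real c *s w \<alpha> = H a b"
    by (simp add: H_def \<alpha> c)
  also have "\<dots> = h c - h a - h b"
    using h_add[OF ab] by (simp add: c)
  also have "\<dots> = (real c * ln (real c) - real a * ln (real a) - real b * ln (real b)) *s \<rho>"
    using ab by (simp add: h_eq L_eq_ln scale_left_diff_distrib c)
  also have "real c * ln (real c) - real a * ln (real a) - real b * ln (real b)
      = real c * entropy \<alpha>"
  proof -
    have "1 - \<alpha> = real b / real c"
      using ac' by (simp add: \<alpha> c field_simps)
    moreover have "ln (real a / real c) = ln (real a) - ln (real c)"
        "ln (real b / real c) = ln (real b) - ln (real c)"
      using ab ac' by (simp_all add: ln_div)
    ultimately have "real c * entropy \<alpha> = real c * (- (real a / real c) * (ln (real a) - ln (real c))
        - (real b / real c) * (ln (real b) - ln (real c)))"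
      by (simp add: entropy_def \<alpha>)
    also have "\<dots> = (real a + real b) * ln (real c) - real a * ln (real a) - real b * ln (real b)"
      using \<open>c \<noteq> 0\<close> by (simp add: field_simps)
    finally show ?thesis by (simp add: c)
  qed
  finally have "real c *s w \<alpha> = real c *s (entropy \<alpha> *s \<rho>)" by simp
  then show ?thesis using \<open>c \<noteq> 0\<close> by (metis of_nat_eq_0_iff scale_left_imp_eq)
qed

end

section \<open>The group of units, written additively\<close>

lemma unit_group_one: "1 \<in> unit_group"
  by (simp add: unit_group_def)

lemma unit_group_mult: "x \<in> unit_group \<Longrightarrow> y \<in> unit_group \<Longrightarrow> x * y \<in> unit_group"
  unfolding unit_group_def using mult_dvd_mono[of x 1 y 1] by simp

lemma unit_group_inverse:
  assumes "x \<in> unit_group"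
  shows "\<exists>y \<in> unit_group. x * y = 1"
  using assms unfolding unit_group_def by (metis dvd_def dvd_triv_right mem_Collect_eq)

text \<open>A copy of the group of units as a type of its own, so that multiplication of units can be
  read as addition of vectors and the vector space theory applies.\<close>

typedef (overloaded) 'a additive_unit = "unit_group :: 'a::comm_semiring_1 set"
  using unit_group_one by blast

instantiation additive_unit :: (comm_semiring_1) ab_group_add
begin

definition "0 = Abs_additive_unit 1"
definition "x + y = Abs_additive_unit (Rep_additive_unit x * Rep_additive_unit y)"
definition "- x = Abs_additive_unit (SOME y. y \<in> unit_group \<and> Rep_additive_unit x * y = 1)"
definition "x - y = x + - (y :: 'a additive_unit)"

lemma Rep_additive_unit_zero: "Rep_additive_unit 0 = 1"
  by (simp add: zero_additive_unit_def Abs_additive_unit_inverse unit_group_one)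

lemma Rep_additive_unit_add:
  "Rep_additive_unit (x + y) = Rep_additive_unit x * Rep_additive_unit y"
  by (simp add: plus_additive_unit_def Abs_additive_unit_inverse unit_group_mult Rep_additive_unit)

lemma Rep_additive_unit_minus: "Rep_additive_unit (- x) * Rep_additive_unit x = 1"
proof -
  have "\<exists>y. y \<in> unit_group \<and> Rep_additive_unit x * y = 1"
    using unit_group_inverse[OF Rep_additive_unit] by blast
  from someI_ex[OF this] show ?thesis
    by (simp add: uminus_additive_unit_def Abs_additive_unit_inverse mult.commute)
qed

instance
proof
  fix x y z :: "'a additive_unit"
  show "x + y + z = x + (y + z)" "x + y = y + x" "0 + x = x"
    by (simp_all add: Rep_additive_unit_inject[symmetric] Rep_additive_unit_add
        Rep_additive_unit_zero mult_ac)
  show "- x + x = 0"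
    by (simp add: Rep_additive_unit_inject[symmetric] Rep_additive_unit_add
        Rep_additive_unit_zero Rep_additive_unit_minus)
  show "x - y = x + - y"
    by (rule minus_additive_unit_def)
qed

end

theorem theorem5p3:
  fixes \<theta> :: "real \<Rightarrow> 'a::cancel_perfect_char_one_semiring \<Rightarrow> 'a"
    and w :: "real \<Rightarrow> 'a"
    and I :: "real set"
  defines "I \<equiv> \<rat> \<inter> {0<..<1}"
  assumes "ordered_real_unit_group \<theta>"
    and "\<And>(s :: nat \<Rightarrow> real) r x y.
          s \<longlonglongrightarrow> r \<Longrightarrow> x \<in> unit_group \<Longrightarrow> y \<in> unit_group \<Longrightarrow>
          (\<And>n. y \<preceq> \<theta> (s n) x) \<Longrightarrow> y \<preceq> \<theta> r x"
    and "\<And>\<alpha>. \<alpha> \<in> I \<Longrightarrow> w \<alpha> \<in> unit_group"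
    and "\<And>\<alpha>. \<alpha> \<in> I \<Longrightarrow> w (1 - \<alpha>) = w \<alpha>"
    and "\<And>\<alpha> \<beta>. \<alpha> \<in> I \<Longrightarrow> \<beta> \<in> I \<Longrightarrow>
          w \<alpha> * \<theta> \<alpha> (w \<beta>)
            = w (\<alpha> * \<beta>) * \<theta> (1 - \<alpha> * \<beta>) (w (\<alpha> * (1 - \<beta>) / (1 - \<alpha> * \<beta>)))"
    and "\<And>\<alpha>. \<alpha> \<in> I \<Longrightarrow> 1 \<preceq> w \<alpha>"
  shows "\<exists>\<rho> \<in> unit_group. 1 \<preceq> \<rho> \<and> (\<forall>\<alpha> \<in> I. w \<alpha> = \<theta> (entropy \<alpha>) \<rho>)"
proof -
  interpret ordered_real_unit_group \<theta> by fact
  note closed_order = assms(3) and w_unit = assms(4) and w_symmetric = assms(5)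
    and w_fundamental = assms(6) and w_ge_1 = assms(7)
  define scale where "scale r x = Abs_additive_unit (\<theta> r (Rep_additive_unit x))" for r x
  define le where "le x y \<longleftrightarrow> Rep_additive_unit x \<preceq> Rep_additive_unit y"
    for x y :: "'a additive_unit"
  define v where "v \<alpha> = Abs_additive_unit (w \<alpha>)" for \<alpha>
  have Rep_scale: "Rep_additive_unit (scale r x) = \<theta> r (Rep_additive_unit x)" for r x
    by (simp add: scale_def Abs_additive_unit_inverse closed Rep_additive_unit)
  have Rep_v: "Rep_additive_unit (v \<alpha>) = w \<alpha>" if "\<alpha> \<in> I" for \<alpha>
    using that by (simp add: v_def Abs_additive_unit_inverse w_unit)
  note Rep_simps = Rep_additive_unit_inject[symmetric] Rep_additive_unit_add
    Rep_additive_unit_zero Rep_scale Rep_additive_unit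
  have I_mult: "\<alpha> * \<beta> \<in> I" if "\<alpha> \<in> I" "\<beta> \<in> I" for \<alpha> \<beta>
    using that mult_strict_mono[of \<alpha> 1 \<beta> 1] by (auto simp: I_def)
  have I_quotient: "\<alpha> * (1 - \<beta>) / (1 - \<alpha> * \<beta>) \<in> I" if "\<alpha> \<in> I" "\<beta> \<in> I" for \<alpha> \<beta>
    using that I_mult[OF that] by (auto simp: I_def field_simps)
  interpret information: nonneg_information_function scale le v
  proof unfold_locales
    show "v (1 - \<alpha>) = v \<alpha>" if "\<alpha> \<in> \<rat> \<inter> {0<..<1}" for \<alpha>
      using that w_symmetric by (simp add: v_def I_def)
    show "le 0 (v \<alpha>)" if "\<alpha> \<in> \<rat> \<inter> {0<..<1}" for \<alpha>
      using that w_ge_1 by (simp add: le_def Rep_simps Rep_v I_def[symmetric])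
    show "v \<alpha> + scale \<alpha> (v \<beta>)
        = v (\<alpha> * \<beta>) + scale (1 - \<alpha> * \<beta>) (v (\<alpha> * (1 - \<beta>) / (1 - \<alpha> * \<beta>)))"
      if "\<alpha> \<in> \<rat> \<inter> {0<..<1}" "\<beta> \<in> \<rat> \<inter> {0<..<1}" for \<alpha> \<beta>
      using that[folded I_def]
      by (simp add: Rep_simps Rep_v I_mult I_quotient w_fundamental)
    show "le y (scale r x)" if "s \<longlonglongrightarrow> r" "\<And>n::nat. le y (scale (s n) x)" for s r x y
      using that closed_order[OF that(1) Rep_additive_unit Rep_additive_unit]
      by (simp add: le_def Rep_scale)
    show "le x z" if "le x y" "le y z" for x y z
      using that char_one_le_trans by (auto simp: le_def)
    show "x = y" if "le x y" "le y x" for x y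
      using that char_one_le_antisym by (metis le_def Rep_additive_unit_inject)
  qed (auto simp: le_def Rep_simps mult add one comp le_mult le_scale char_one_le_refl)
  define \<rho> where "\<rho> = Rep_additive_unit information.\<rho>"
  have "\<rho> \<in> unit_group"
    by (simp add: \<rho>_def Rep_additive_unit)
  moreover have "1 \<preceq> \<rho>"
    using information.\<rho>_nonneg by (simp add: le_def \<rho>_def Rep_simps)
  moreover have "w \<alpha> = \<theta> (entropy \<alpha>) \<rho>" if "\<alpha> \<in> I" for \<alpha>
    using information.eq_entropy[of \<alpha>] that Rep_v[OF that]
    by (simp add: I_def[symmetric] \<rho>_def Rep_scale)
  ultimately show ?thesis by blast
qed

end
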